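(* Let $K$ be a field, let $P=K[x_1,\dots,x_n]$, let $\mathfrak{M}=\langle x_1,\dots,x_n\rangle$, and let $Z=(z_1,\dots,z_s)$, $1\le s\le n$, be a tuple of distinct indeterminates in $\{x_1,\dots,x_n\}$. Let $Y$ be the tuple of the remaining indeterminates and $\widehat{P}=K[Y]$. Let $I\subseteq\mathfrak{M}$ be an ideal in $P$, and let $\sigma$ be a term ordering on $\mathbb{T}^n$. Then the following conditions are equivalent. (a) The term ordering $\sigma$ is a $Z$-separating term ordering for $I$. (b) There exist polynomials $f_1,\dots,f_s\in I\setminus\{0\}$ such that $\sigma$ is a $Z$-separating term ordering for $F=(f_1,\dots,f_s)$, i.e., such that $\mathrm{LT}_\sigma(f_i)=z_i$ for $i=1,\dots,s$. (c) There exist polynomials $f_1,\dots,f_s\in I\setminus\{0\}$ such that $\mathrm{LT}_\sigma(f_i)=z_i$ for $i=1,\dots,s$ and $F=(f_1,\dots,f_s)$ is coherently $Z$-separating. (d) The reduced $\sigma$-Gröbner basis of $I$ has the shape $\{f_1,\dots,f_s,\,g_1,\dots,g_t\}$, where $F=(f_1,\dots,f_s)$ is a coherently $Z$-separating tuple and $\{g_1,\dots,g_t\}$ is the reduced $\sigma_Y$-Gröbner basis of $I\cap\widehat{P}$.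
   Context: $\mathbb{T}^n$ is the monoid of terms (power products) in $x_1,\dots,x_n$; a term ordering is a multiplicative total well-ordering on it. $\mathrm{LT}_\sigma(f)$ is the $\sigma$-largest term in the support of $f$, $\mathrm{LC}_\sigma(f)$ is its coefficient, and $\mathrm{LT}_\sigma(J)$ is the ideal generated by the leading terms of the nonzero elements of an ideal $J$. The restriction of $\sigma$ to $K[Y]$ is denoted by $\sigma_Y$. Definitions. For $f_1,\dots,f_s\in\mathfrak{M}\setminus\{0\}$, let $F=(f_1,\dots,f_s)$ and $I_F=\langle f_1,\dots,f_s\rangle$. - The tuple $F$ is called $Z$-separating if there exists a term ordering $\sigma$ such that $\mathrm{LT}_\sigma(f_i)=z_i$ for $i=1,\dots,s$. In this case $\sigma$ is called a $Z$-separating term ordering for the tuple $F$. - The tuple $F$ is called coherently $Z$-separating if it is $Z$-separating, i.e., there exists a term ordering $\tau$ such that $\mathrm{LT}_\tau(f_i)=z_i$ for $i=1,\dots,s$, and if, additionally, the reduced $\tau$-Gröbner basis of $I_F$ is $\{\frac{1}{c_1}f_1,\dots,\frac{1}{c_s}f_s\}$, where $c_i=\mathrm{LC}_\tau(f_i)$ for $i=1,\dots,s$. - The ideal $I_F$ is called $Z$-separating if there exists a term ordering $\sigma$ such that $\mathrm{LT}_\sigma(I_F)=\langle z_1,\dots,z_s\rangle$. In this case $\sigma$ is called a $Z$-separating term ordering for $I_F$. - For an ideal $I\subseteq\mathfrak{M}$ of $P$, a term ordering $\sigma$ on $\mathbb{T}^n$ is called a $Z$-separating term ordering for $I$ if there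 exist polynomials $f_1,\dots,f_s\in I\setminus\{0\}$ such that $\sigma$ is a $Z$-separating term ordering for the ideal $I_F=\langle f_1,\dots,f_s\rangle$.
   Formalization: In (d) it is also required that LT_σ(f_i)=z_i for all i; otherwise (d) does not imply (a), e.g. for I=⟨z−y²⟩ with σ degree-compatible, where F=(y²−z) is coherently Z-separating only for another ordering τ. *)

theory Defs
  imports "HOL-Library.Poly_Mapping" "HOL-Algebra.Ideal"
begin

text \<open>
  The indeterminates are the elements of a type \<open>'x\<close>; in the theorem this type is finite
  and nonempty, so that \<open>n = CARD('x)\<close>. A term (power product) is its exponent vector, hence
  products of terms are written additively. The polynomial ring in a set \<open>V\<close> of indeterminates
  consists of the finitely supported maps from terms to coefficients whose support only
  involves \<open>V\<close>. Thus \<open>P\<close> is the case \<open>V = UNIV\<close>, and \<open>K[Y]\<close> is literally a subring of \<open>P\<close>.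
\<close>

type_synonym 'x pp = "'x \<Rightarrow>\<^sub>0 nat"
type_synonym ('x, 'a) mpoly = "'x pp \<Rightarrow>\<^sub>0 'a"

definition terms_in :: "'x set \<Rightarrow> 'x pp set" where
  "terms_in V = {t. Poly_Mapping.keys t \<subseteq> V}"

definition mpoly_ring :: "'x set \<Rightarrow> ('x, 'a::field) mpoly ring" where
  "mpoly_ring V =
     \<lparr>carrier = {f. Poly_Mapping.keys f \<subseteq> terms_in V}, mult = (*), one = 1, zero = 0, add = (+)\<rparr>"

definition var :: "'x \<Rightarrow> 'x pp" where
  "var x = Poly_Mapping.single x 1"

definition term_poly :: "'x pp \<Rightarrow> ('x, 'a::field) mpoly" where
  "term_poly t = Poly_Mapping.single t 1"

definition const_poly :: "'a \<Rightarrow> ('x, 'a::field) mpoly" where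
  "const_poly c = Poly_Mapping.single 0 c"

definition maximal_ideal_vars :: "('x, 'a::field) mpoly set" where
  "maximal_ideal_vars = Idl\<^bsub>mpoly_ring UNIV\<^esub> (range (\<lambda>x. term_poly (var x)))"

definition gen_ideal :: "('x, 'a::field) mpoly list \<Rightarrow> ('x, 'a) mpoly set" where
  "gen_ideal fs = Idl\<^bsub>mpoly_ring UNIV\<^esub> (set fs)"

text \<open>\<open>(s, t) \<in> \<sigma>\<close> is read as \<open>s \<le>\<^sub>\<sigma> t\<close>.\<close>

definition term_ordering_on :: "'x set \<Rightarrow> 'x pp rel \<Rightarrow> bool" where
  "term_ordering_on V \<sigma> \<longleftrightarrow>
     well_order_on (terms_in V) \<sigma> \<and>
     (\<forall>s t. \<forall>u \<in> terms_in V. (s, t) \<in> \<sigma> \<longrightarrow> (s + u, t + u) \<in> \<sigma>)"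

abbreviation term_ordering :: "'x pp rel \<Rightarrow> bool" where
  "term_ordering \<equiv> term_ordering_on UNIV"

definition restrict_ordering :: "'x pp rel \<Rightarrow> 'x set \<Rightarrow> 'x pp rel" where
  "restrict_ordering \<sigma> V = Restr \<sigma> (terms_in V)"

text \<open>Only meaningful for nonzero polynomials.\<close>

definition LT :: "'x pp rel \<Rightarrow> ('x, 'a::field) mpoly \<Rightarrow> 'x pp" where
  "LT \<sigma> f = (THE t. t \<in> Poly_Mapping.keys f \<and> (\<forall>u \<in> Poly_Mapping.keys f. (u, t) \<in> \<sigma>))"

definition LC :: "'x pp rel \<Rightarrow> ('x, 'a::field) mpoly \<Rightarrow> 'a" where
  "LC \<sigma> f = Poly_Mapping.lookup f (LT \<sigma> f)"

definition LT_ideal ::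
  "'x set \<Rightarrow> 'x pp rel \<Rightarrow> ('x, 'a::field) mpoly set \<Rightarrow> ('x, 'a) mpoly set" where
  "LT_ideal V \<sigma> J = Idl\<^bsub>mpoly_ring V\<^esub> ((\<lambda>f. term_poly (LT \<sigma> f)) ` (J - {0}))"

definition groebner_basis ::
  "'x set \<Rightarrow> 'x pp rel \<Rightarrow> ('x, 'a::field) mpoly set \<Rightarrow> ('x, 'a) mpoly set \<Rightarrow> bool" where
  "groebner_basis V \<sigma> J G \<longleftrightarrow>
     finite G \<and> G \<subseteq> J - {0} \<and>
     LT_ideal V \<sigma> J = Idl\<^bsub>mpoly_ring V\<^esub> ((\<lambda>g. term_poly (LT \<sigma> g)) ` G)"

text \<open>
  Monic, and no term of an element is divisible by the leading term of another element
  (\<open>t = LT \<sigma> h + u\<close> is divisibility of terms in additive notation). For a term ordering on the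
  terms in a finite set \<open>V\<close>, every ideal of \<open>mpoly_ring V\<close> has exactly one such basis.
\<close>

definition reduced_groebner_basis ::
  "'x set \<Rightarrow> 'x pp rel \<Rightarrow> ('x, 'a::field) mpoly set \<Rightarrow> ('x, 'a) mpoly set \<Rightarrow> bool" where
  "reduced_groebner_basis V \<sigma> J G \<longleftrightarrow>
     groebner_basis V \<sigma> J G \<and>
     (\<forall>g \<in> G. LC \<sigma> g = 1 \<and>
       (\<forall>h \<in> G - {g}. \<forall>t \<in> Poly_Mapping.keys g. \<not> (\<exists>u. t = LT \<sigma> h + u)))"

definition separating_ordering_tuple ::
  "'x list \<Rightarrow> 'x pp rel \<Rightarrow> ('x, 'a::field) mpoly list \<Rightarrow> bool" where
  "separating_ordering_tuple zs \<sigma> fs \<longleftrightarrow>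
     term_ordering \<sigma> \<and> length fs = length zs \<and> set fs \<subseteq> maximal_ideal_vars - {0} \<and>
     (\<forall>i < length zs. LT \<sigma> (fs ! i) = var (zs ! i))"

text \<open>
  The ordering \<open>\<tau>\<close> is part of the existential statement. In particular, a coherently separating
  tuple \<open>F\<close> need not satisfy \<open>LT \<sigma> f\<^sub>i = z\<^sub>i\<close> for another term ordering \<open>\<sigma>\<close>.
\<close>

definition coherently_separating_tuple :: "'x list \<Rightarrow> ('x, 'a::field) mpoly list \<Rightarrow> bool" where
  "coherently_separating_tuple zs fs \<longleftrightarrow>
     (\<exists>\<tau>. separating_ordering_tuple zs \<tau> fs \<and>
        reduced_groebner_basis UNIV \<tau> (gen_ideal fs)
          ((\<lambda>f. const_poly (1 / LC \<tau> f) * f) ` set fs))"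

definition separating_ordering_gen_ideal ::
  "'x list \<Rightarrow> 'x pp rel \<Rightarrow> ('x, 'a::field) mpoly list \<Rightarrow> bool" where
  "separating_ordering_gen_ideal zs \<sigma> fs \<longleftrightarrow>
     term_ordering \<sigma> \<and> length fs = length zs \<and> set fs \<subseteq> maximal_ideal_vars - {0} \<and>
     LT_ideal UNIV \<sigma> (gen_ideal fs) = Idl\<^bsub>mpoly_ring UNIV\<^esub> ((\<lambda>z. term_poly (var z)) ` set zs)"

definition separating_ordering_ideal ::
  "'x list \<Rightarrow> 'x pp rel \<Rightarrow> ('x, 'a::field) mpoly set \<Rightarrow> bool" where
  "separating_ordering_ideal zs \<sigma> I \<longleftrightarrow>
     (\<exists>fs. length fs = length zs \<and> set fs \<subseteq> I - {0} \<and> separating_ordering_gen_ideal zs \<sigma> fs)"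

end

theory Submission
  imports Defs Complex_Main
begin

text \<open>
  The step that matters leads from polynomials \<open>f\<^sub>i \<in> I\<close> with leading terms \<open>z\<^sub>i\<close> to the shape of the
  reduced Groebner basis of \<open>I\<close>. Modulo \<open>I\<close>, each term is congruent to a normal form, that is, to a
  combination of terms which are not leading terms of \<open>I\<close> and are not larger (\<open>normal_form\<close>). If \<open>m\<close> is a
  leading term of \<open>I\<close>, the difference \<open>b m\<close> of \<open>m\<close> and its normal form is therefore a monic element
  of \<open>I\<close> with leading term \<open>m\<close> whose other terms are not leading terms of \<open>I\<close>. The leading terms of \<open>I\<close>
  that are minimal for divisibility are finite in number by Dickson's lemma, and the \<open>b m\<close> for these \<open>m\<close>
  are the reduced Groebner basis of \<open>I\<close> (\<open>leading_basis\<close>).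

  Since \<open>I\<close> has no nonzero constant, each \<open>z\<^sub>i\<close> is one of the minimal leading terms. A term divisible by
  some \<open>z\<^sub>i\<close> is a leading term of \<open>I\<close>, so apart from \<open>m\<close> itself all terms of \<open>b m\<close> are terms in \<open>Y\<close>. Hence
  the \<open>b m\<close> with \<open>m\<close> not among the \<open>z\<^sub>i\<close> lie in \<open>K[Y]\<close>, and they are the reduced Groebner basis of
  \<open>I \<inter> K[Y]\<close> (\<open>elimination_basis\<close>).

  The remaining elements have the form \<open>z\<^sub>i - p\<^sub>i\<close> with \<open>p\<^sub>i \<in> K[Y]\<close> and all terms of \<open>p\<^sub>i\<close> smaller
  than \<open>z\<^sub>i\<close>. The substitution \<open>z\<^sub>i \<mapsto> p\<^sub>i\<close> annihilates the ideal that they generate. It does not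
  annihilate a polynomial whose leading term is in \<open>Y\<close>: it fixes this term, and it turns every other
  term of the polynomial into a combination of terms below the leading term. Hence every leading term of the generated ideal is
  divisible by some \<open>z\<^sub>i\<close>, and the \<open>z\<^sub>i - p\<^sub>i\<close> form its reduced Groebner basis (\<open>gen_ideal_basis\<close>).
  This gives (a), (c) and (d). In the other direction, (d) implies (c) and (c) implies (b) at once, and
  (a) implies (b) because \<open>z\<^sub>i\<close> is a multiple of some leading term of the generated ideal, and this
  leading term is not \<open>1\<close>.
\<close>

section \<open>Polynomial rings and their ideals\<close>

lemma mpoly_ring_simps [simp]:
  "carrier (mpoly_ring V) = {f. Poly_Mapping.keys f \<subseteq> terms_in V}"
  "f \<otimes>\<^bsub>mpoly_ring V\<^esub> g = f * g" "\<one>\<^bsub>mpoly_ring V\<^esub> = 1" "\<zero>\<^bsub>mpoly_ring V\<^esub> = 0"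
  "f \<oplus>\<^bsub>mpoly_ring V\<^esub> g = f + g"
  by (simp_all add: mpoly_ring_def)

lemma terms_in_UNIV [simp]: "terms_in UNIV = UNIV"
  by (simp add: terms_in_def)

lemma terms_in_add: "s \<in> terms_in V \<Longrightarrow> t \<in> terms_in V \<Longrightarrow> s + t \<in> terms_in V"
  using keys_add[of s t] by (auto simp: terms_in_def)

lemma terms_in_addD2: "s + t \<in> terms_in V \<Longrightarrow> t \<in> terms_in V"
  by (auto simp: terms_in_def in_keys_iff lookup_add)

lemma keys_mult_terms_in:
  "Poly_Mapping.keys f \<subseteq> terms_in V \<Longrightarrow> Poly_Mapping.keys g \<subseteq> terms_in V \<Longrightarrow>
    Poly_Mapping.keys (f * g) \<subseteq> terms_in V"
  using keys_mult[of f g] by (fastforce intro: terms_in_add)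

lemma keys_uminus: "Poly_Mapping.keys (- f) = Poly_Mapping.keys (f :: ('x, 'a::field) mpoly)"
  by (auto simp: in_keys_iff)

lemma cring_mpoly_ring: "cring (mpoly_ring V :: ('x, 'a::field) mpoly ring)"
proof (rule cringI)
  show "abelian_group (mpoly_ring V :: ('x, 'a) mpoly ring)"
  proof (rule abelian_groupI, goal_cases)
    case (1 x y)
    then show ?case using keys_add[of x y] by auto
  next
    case (6 x)
    then show ?case by (intro bexI[of _ "- x"]) (simp_all add: keys_uminus)
  qed (auto simp: algebra_simps)
  show "Group.comm_monoid (mpoly_ring V :: ('x, 'a) mpoly ring)"
  proof (rule comm_monoidI, goal_cases)
    case (1 x y)
    then show ?case using keys_mult_terms_in[of x V y] by simp
  qed (auto simp: algebra_simps terms_in_def)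
qed (simp add: algebra_simps)

lemmas ring_mpoly_ring = cring.axioms(1)[OF cring_mpoly_ring]

lemma mpoly_ideal_closed:
  assumes "ideal J (mpoly_ring V)"
  shows "0 \<in> J" "f \<in> J \<Longrightarrow> g \<in> J \<Longrightarrow> f + g \<in> J"
    "f \<in> J \<Longrightarrow> Poly_Mapping.keys g \<subseteq> terms_in V \<Longrightarrow> g * f \<in> J"
proof -
  interpret ideal J "mpoly_ring V" by fact
  show "0 \<in> J" using additive_subgroup.zero_closed[OF is_additive_subgroup] by simp
  show "f + g \<in> J" if "f \<in> J" "g \<in> J"
    using additive_subgroup.a_closed[OF is_additive_subgroup that] by simp
  show "g * f \<in> J" if "f \<in> J" "Poly_Mapping.keys g \<subseteq> terms_in V"
    using I_l_closed[of f g] that by simp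
qed

lemma mpoly_ideal_sum:
  assumes "ideal J (mpoly_ring V)" "\<And>i. i \<in> A \<Longrightarrow> f i \<in> J"
  shows "sum f A \<in> J"
  using assms(2)
  by (induction A rule: infinite_finite_induct) (auto intro: mpoly_ideal_closed[OF assms(1)])

lemma mpoly_idealI:
  assumes "J \<subseteq> carrier (mpoly_ring V)" "0 \<in> J" "\<And>f g. f \<in> J \<Longrightarrow> g \<in> J \<Longrightarrow> f + g \<in> J"
    and mult: "\<And>f g. f \<in> J \<Longrightarrow> Poly_Mapping.keys g \<subseteq> terms_in V \<Longrightarrow> g * f \<in> J"
  shows "ideal J (mpoly_ring V :: ('x, 'a::field) mpoly ring)"
proof -
  interpret cring "mpoly_ring V :: ('x, 'a) mpoly ring" by (rule cring_mpoly_ring)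
  show ?thesis
  proof (rule idealI[OF ring_mpoly_ring])
    show "subgroup J (add_monoid (mpoly_ring V))"
    proof (rule add.subgroupI)
      fix f assume f: "f \<in> J"
      then have "- f \<in> J" using mult[of f "- 1"] by (auto simp: terms_in_def)
      moreover have "\<ominus>\<^bsub>mpoly_ring V\<^esub> f = - f"
        using f assms(1) by (intro minus_equality) auto
      ultimately show "\<ominus>\<^bsub>mpoly_ring V\<^esub> f \<in> J" by simp
    qed (use assms in auto)
  qed (use assms in \<open>auto simp: mult.commute\<close>)
qed

lemma const_poly_mult_term_poly: "const_poly c * term_poly t = Poly_Mapping.single t c"
  by (simp add: const_poly_def term_poly_def mult_single)

lemma lookup_const_poly_mult:
  "Poly_Mapping.lookup (const_poly c * f) t = c * Poly_Mapping.lookup f t"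
  by (simp add: const_poly_def mult_map_scale_conv_mult[symmetric] map.rep_eq when_def)

lemma keys_const_poly_mult: "Poly_Mapping.keys (const_poly c * f) \<subseteq> Poly_Mapping.keys f"
  by (auto simp: in_keys_iff lookup_const_poly_mult)

lemma const_poly_1: "const_poly 1 = 1"
  by (simp add: const_poly_def)

lemma keys_term_poly [simp]: "Poly_Mapping.keys (term_poly t) = {t}"
  by (simp add: term_poly_def)

lemma term_poly_0: "term_poly 0 = 1"
  by (simp add: term_poly_def)

lemma term_poly_add: "term_poly (s + t) = term_poly s * term_poly t"
  by (simp add: term_poly_def mult_single)

lemma poly_eq_sum_monomials:
  "f = (\<Sum>t \<in> Poly_Mapping.keys f. const_poly (Poly_Mapping.lookup f t) * term_poly t)"
  by (rule poly_mapping_eqI)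
    (simp add: lookup_sum const_poly_mult_term_poly lookup_single when_def in_keys_iff)

lemma lookup_term_poly_mult:
  fixes f :: "('x, 'a::field) mpoly"
  shows "Poly_Mapping.lookup (term_poly u * f) (u + t) = Poly_Mapping.lookup f t"
proof -
  have "term_poly u * f =
      (\<Sum>s \<in> Poly_Mapping.keys f. const_poly (Poly_Mapping.lookup f s) * term_poly (u + s))"
    by (subst poly_eq_sum_monomials[of f])
      (simp add: sum_distrib_left term_poly_add mult.left_commute)
  then show ?thesis
    by (simp add: lookup_sum const_poly_mult_term_poly lookup_single when_def in_keys_iff)
qed

section \<open>Monomial ideals\<close>

text \<open>A monomial ideal contains only polynomials all of whose terms are multiples of generators.\<close>

lemma keys_in_monomial_ideal:
  fixes f :: "('x, 'a::field) mpoly"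
  assumes "f \<in> Idl\<^bsub>mpoly_ring UNIV\<^esub> (term_poly ` T)" "u \<in> Poly_Mapping.keys f"
  shows "\<exists>t \<in> T. \<exists>v. u = t + v"
proof -
  let ?J = "{f :: ('x, 'a) mpoly. \<forall>u \<in> Poly_Mapping.keys f. \<exists>t \<in> T. \<exists>v. u = t + v}"
  have "ideal ?J (mpoly_ring UNIV)"
  proof (rule mpoly_idealI)
    fix f g :: "('x, 'a) mpoly" assume f: "f \<in> ?J"
    show "f + g \<in> ?J" if "g \<in> ?J" using f that keys_add[of f g] by blast
    show "g * f \<in> ?J"
    proof clarsimp
      fix w assume "w \<in> Poly_Mapping.keys (g * f)"
      then obtain a b where w: "w = a + b" "b \<in> Poly_Mapping.keys f" using keys_mult[of g f] by blast
      from f this(2) obtain t v where "t \<in> T" "b = t + v" by blast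
      with w show "\<exists>t \<in> T. \<exists>v. w = t + v" by (metis add.left_commute)
    qed
  qed auto
  moreover have "term_poly ` T \<subseteq> ?J" by (force intro: exI[of _ 0])
  ultimately have "Idl\<^bsub>mpoly_ring UNIV\<^esub> (term_poly ` T) \<subseteq> ?J"
    by (rule ring.genideal_minimal[OF ring_mpoly_ring])
  with assms show ?thesis by blast
qed

lemma maximal_ideal_vars_0:
  fixes f :: "('x, 'a::field) mpoly"
  assumes "f \<in> maximal_ideal_vars" shows "0 \<notin> Poly_Mapping.keys f"
proof
  assume "0 \<in> Poly_Mapping.keys f"
  moreover have "f \<in> Idl\<^bsub>mpoly_ring UNIV\<^esub> (term_poly ` range var)"
    using assms by (simp add: maximal_ideal_vars_def image_image)
  ultimately obtain x v where "0 = var (x :: 'x) + v" using keys_in_monomial_ideal[of f "range var" 0] by blast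
  then have "Poly_Mapping.lookup 0 x = Poly_Mapping.lookup (var x + v) x" by simp
  then show False by (simp add: lookup_add var_def)
qed

lemma monomial_ideal_mono:
  assumes T: "T \<subseteq> terms_in V" and S: "\<And>s. s \<in> S \<Longrightarrow> \<exists>t \<in> T. \<exists>u \<in> terms_in V. s = t + u"
  shows "Idl\<^bsub>mpoly_ring V\<^esub> (term_poly ` S) \<subseteq>
    (Idl\<^bsub>mpoly_ring V\<^esub> (term_poly ` T) :: ('x, 'a::field) mpoly set)"
proof -
  interpret cring "mpoly_ring V :: ('x, 'a) mpoly ring" by (rule cring_mpoly_ring)
  let ?T = "term_poly ` T :: ('x, 'a) mpoly set"
  have c: "?T \<subseteq> carrier (mpoly_ring V)" using T by auto
  note id = genideal_ideal[OF c]
  show ?thesis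
  proof (rule genideal_minimal[OF id], clarify)
    fix s assume "s \<in> S"
    then obtain t u where "t \<in> T" "u \<in> terms_in V" "s = u + t" using S by (metis add.commute)
    then show "term_poly s \<in> Idl\<^bsub>mpoly_ring V\<^esub> ?T"
      using genideal_self[OF c] by (auto simp: term_poly_add intro!: mpoly_ideal_closed(3)[OF id])
  qed
qed

text \<open>A finite set of nonzero elements of \<open>J\<close> is a Groebner basis if each leading term of \<open>J\<close> is a
  multiple of the leading term of one of them. Nothing is required of the relation \<open>\<sigma>\<close> except that leading terms
  of elements of \<open>J\<close> exist, so that it may also be a restriction of a term ordering.\<close>

lemma groebner_basisI:
  assumes "finite G" "G \<subseteq> J - {0}" and J: "J \<subseteq> carrier (mpoly_ring V)"
    and LT: "\<And>f. f \<in> J - {0} \<Longrightarrow> LT \<sigma> f \<in> Poly_Mapping.keys f"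
    and dvd: "\<And>f. f \<in> J - {0} \<Longrightarrow> \<exists>g \<in> G. \<exists>u. LT \<sigma> f = LT \<sigma> g + u"
  shows "groebner_basis V \<sigma> J G"
proof -
  have LTV: "LT \<sigma> f \<in> terms_in V" if "f \<in> J - {0}" for f using LT[OF that] J that by auto
  have "Idl\<^bsub>mpoly_ring V\<^esub> (term_poly ` LT \<sigma> ` (J - {0})) = Idl\<^bsub>mpoly_ring V\<^esub> (term_poly ` LT \<sigma> ` G)"
  proof (intro equalityI monomial_ideal_mono)
    fix s assume "s \<in> LT \<sigma> ` (J - {0})"
    then obtain f where f: "f \<in> J - {0}" "s = LT \<sigma> f" by blast
    with dvd obtain g u where g: "g \<in> G" "s = LT \<sigma> g + u" by blast
    moreover have "u \<in> terms_in V" using LTV f g terms_in_addD2 by metis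
    ultimately show "\<exists>t \<in> LT \<sigma> ` G. \<exists>u \<in> terms_in V. s = t + u" by blast
  next
    fix s assume "s \<in> LT \<sigma> ` G"
    then show "\<exists>t \<in> LT \<sigma> ` (J - {0}). \<exists>u \<in> terms_in V. s = t + u"
      using assms(2) by (intro bexI[of _ s] bexI[of _ 0]) (auto simp: terms_in_def)
  qed (use LTV assms(2) in auto)
  then show ?thesis using assms(1,2) by (simp add: groebner_basis_def LT_ideal_def image_image)
qed

section \<open>Dickson's lemma\<close>

text \<open>A sequence of exponent vectors has a subsequence along which each of finitely many coordinates is
  nondecreasing.\<close>

lemma mono_subsequence_family:
  fixes f :: "nat \<Rightarrow> 'x \<Rightarrow> nat"
  assumes "finite A"
  shows "\<exists>r :: nat \<Rightarrow> nat. strict_mono r \<and> (\<forall>x \<in> A. mono (\<lambda>n. f (r n) x))"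
  using assms
proof (induction A rule: finite_induct)
  case empty
  show ?case by (auto intro: exI[of _ id] simp: strict_mono_def)
next
  case (insert x A)
  then obtain r :: "nat \<Rightarrow> nat" where r: "strict_mono r" "\<forall>y \<in> A. mono (\<lambda>n. f (r n) y)" by blast
  obtain q :: "nat \<Rightarrow> nat" where q: "strict_mono q" "monoseq (\<lambda>n. f (r (q n)) x)"
    using seq_monosub[of "\<lambda>n. f (r n) x"] by blast
  have "\<exists>N. mono (\<lambda>n. f (r (q (n + N))) x)"
  proof (cases "mono (\<lambda>n. f (r (q n)) x)")
    case True
    then show ?thesis by (intro exI[of _ 0]) simp
  next
    case False
    then have dec: "f (r (q n)) x \<le> f (r (q m)) x" if "m \<le> n" for m n
      using q(2) that by (auto simp: monoseq_def mono_def)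
    \<comment> \<open>A decreasing sequence of naturals is constant from the place of its minimum on.\<close>
    define N where "N = (ARG_MIN (\<lambda>n. f (r (q n)) x) n. True)"
    have min: "f (r (q N)) x \<le> f (r (q n)) x" for n
      unfolding N_def by (rule arg_min_nat_le) simp
    have "f (r (q (n + N))) x = f (r (q N)) x" for n using min dec by (simp add: order_antisym)
    then show ?thesis by (intro exI[of _ N]) (simp add: mono_def)
  qed
  then obtain N where N: "mono (\<lambda>n. f (r (q (n + N))) x)" by blast
  have "strict_mono (\<lambda>n. r (q (n + N)))" using r(1) q(1) by (simp add: strict_mono_def)
  moreover have "mono (\<lambda>n. f (r (q (n + N))) y)" if "y \<in> A" for y
    using r(2) that q(1) by (auto simp: mono_def strict_mono_less_eq)
  ultimately show ?case using N by (intro exI[of _ "\<lambda>n. r (q (n + N))"]) auto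
qed

lemma pp_dvd_iff:
  "(\<exists>u. t = s + u) \<longleftrightarrow> (\<forall>x. Poly_Mapping.lookup s x \<le> Poly_Mapping.lookup (t :: 'x pp) x)"
proof
  assume "\<forall>x. Poly_Mapping.lookup s x \<le> Poly_Mapping.lookup t x"
  then have "t = s + (t - s)" by (intro poly_mapping_eqI) (simp add: lookup_add lookup_minus)
  then show "\<exists>u. t = s + u" by blast
qed (auto simp: lookup_add)

text \<open>Dickson's lemma, for antichains of the divisibility order.\<close>

lemma dickson:
  fixes M :: "'x::finite pp set"
  assumes "\<And>s t u. s \<in> M \<Longrightarrow> t \<in> M \<Longrightarrow> t = s + u \<Longrightarrow> s = t"
  shows "finite M"
proof (rule ccontr)
  assume "infinite M"
  then obtain e :: "nat \<Rightarrow> 'x pp" where e: "inj e" "range e \<subseteq> M"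
    using infinite_countable_subset by blast
  obtain r :: "nat \<Rightarrow> nat" where r: "strict_mono r"
      "\<forall>x \<in> UNIV. mono (\<lambda>n. Poly_Mapping.lookup (e (r n)) x)"
    using mono_subsequence_family[of UNIV "\<lambda>n. Poly_Mapping.lookup (e n)"] by auto
  then have "\<exists>u. e (r 1) = e (r 0) + u" by (auto simp: pp_dvd_iff mono_def)
  then have "e (r 0) = e (r 1)" using assms e(2) by blast
  with e(1) have "r 0 = r 1" by (simp add: inj_eq)
  with r(1) show False by (metis strict_mono_eq zero_neq_one)
qed

text \<open>The elements of \<open>L\<close> that are minimal for divisibility within \<open>L\<close>.\<close>

definition minimal_terms :: "'x pp set \<Rightarrow> 'x pp set" where
  "minimal_terms L = {m \<in> L. \<forall>t \<in> L. \<forall>u. m = t + u \<longrightarrow> t = m}"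

lemma finite_minimal_terms: "finite (minimal_terms (L :: 'x::finite pp set))"
  by (rule dickson) (auto simp: minimal_terms_def)

lemma minimal_term_dvd:
  fixes t :: "'x::finite pp"
  assumes "t \<in> L"
  shows "\<exists>m \<in> minimal_terms L. \<exists>u. t = m + u"
  using assms
proof (induction "\<Sum>x \<in> UNIV. Poly_Mapping.lookup t x" arbitrary: t rule: less_induct)
  case less
  show ?case
  proof (cases "t \<in> minimal_terms L")
    case True
    then show ?thesis by (intro bexI[of _ t] exI[of _ 0]) auto
  next
    case False
    then obtain s u where s: "s \<in> L" "t = s + u" "s \<noteq> t" using less.prems by (auto simp: minimal_terms_def)
    then obtain x where "0 < Poly_Mapping.lookup u x"
      by (metis add.right_neutral gr0I lookup_zero poly_mapping_eqI)
    then have "(\<Sum>x \<in> UNIV. Poly_Mapping.lookup s x) < (\<Sum>x \<in> UNIV. Poly_Mapping.lookup t x)"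
      using s(2) by (intro sum_strict_mono_ex1) (auto simp: lookup_add)
    then obtain m v where "m \<in> minimal_terms L" "s = m + v" using less.hyps s(1) by blast
    with s(2) show ?thesis by (metis add.assoc)
  qed
qed

section \<open>Term orderings and reduced Groebner bases\<close>

text \<open>A term ordering \<open>\<sigma>\<close> on all terms in finitely many indeterminates, fixed for what follows.\<close>

locale term_order =
  fixes \<sigma> :: "'x::finite pp rel"
  assumes term_ordering: "term_ordering \<sigma>"
begin

lemma ord_refl: "(t, t) \<in> \<sigma>"
  and ord_trans: "(s, t) \<in> \<sigma> \<Longrightarrow> (t, u) \<in> \<sigma> \<Longrightarrow> (s, u) \<in> \<sigma>"
  and ord_antisym: "(s, t) \<in> \<sigma> \<Longrightarrow> (t, s) \<in> \<sigma> \<Longrightarrow> s = t"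
  and ord_total: "(s, t) \<in> \<sigma> \<or> (t, s) \<in> \<sigma>"
  and ord_add: "(s, t) \<in> \<sigma> \<Longrightarrow> (s + u, t + u) \<in> \<sigma>"
  and ord_wf: "wf (\<sigma> - Id)"
proof -
  have *: "refl_on UNIV \<sigma>" "trans \<sigma>" "antisym \<sigma>" "total_on UNIV \<sigma>" "wf (\<sigma> - Id)"
    "\<And>s t u. (s, t) \<in> \<sigma> \<Longrightarrow> (s + u, t + u) \<in> \<sigma>"
    using term_ordering by (auto simp: term_ordering_on_def well_order_on_def order_on_defs)
  from *(1) show refl: "(t, t) \<in> \<sigma>" for t by (auto simp: refl_on_def)
  from *(2) show "(s, t) \<in> \<sigma> \<Longrightarrow> (t, u) \<in> \<sigma> \<Longrightarrow> (s, u) \<in> \<sigma>" by (auto dest: transD)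
  from *(3) show "(s, t) \<in> \<sigma> \<Longrightarrow> (t, s) \<in> \<sigma> \<Longrightarrow> s = t" by (auto dest: antisymD)
  from *(4) refl show "(s, t) \<in> \<sigma> \<or> (t, s) \<in> \<sigma>" by (cases "s = t") (auto simp: total_on_def)
  from *(6) show "(s, t) \<in> \<sigma> \<Longrightarrow> (s + u, t + u) \<in> \<sigma>" .
  from *(5) show "wf (\<sigma> - Id)" .
qed

lemma ord_add_mono: "(s, t) \<in> \<sigma> \<Longrightarrow> (s', t') \<in> \<sigma> \<Longrightarrow> (s + s', t + t') \<in> \<sigma>"
  by (metis ord_add ord_trans add.commute)

lemma LT_eqI:
  "t \<in> Poly_Mapping.keys f \<Longrightarrow> (\<And>u. u \<in> Poly_Mapping.keys f \<Longrightarrow> (u, t) \<in> \<sigma>) \<Longrightarrow> LT \<sigma> f = t"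
  unfolding LT_def using ord_antisym by blast

lemma ex_max: "finite A \<Longrightarrow> A \<noteq> {} \<Longrightarrow> \<exists>t \<in> A. \<forall>u \<in> A. (u, t) \<in> \<sigma>"
proof (induction A rule: finite_ne_induct)
  case (insert s A)
  then obtain t where "t \<in> A" "\<forall>u \<in> A. (u, t) \<in> \<sigma>" by blast
  with ord_total[of s t] show ?case using ord_refl ord_trans by (metis insert_iff)
qed (simp add: ord_refl)

lemma
  assumes "f \<noteq> 0"
  shows LT_in_keys: "LT \<sigma> f \<in> Poly_Mapping.keys f"
    and LT_max: "u \<in> Poly_Mapping.keys f \<Longrightarrow> (u, LT \<sigma> f) \<in> \<sigma>"
proof -
  obtain t where "t \<in> Poly_Mapping.keys f" "\<forall>u \<in> Poly_Mapping.keys f. (u, t) \<in> \<sigma>"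
    using ex_max[of "Poly_Mapping.keys f"] assms by auto
  moreover from this have "LT \<sigma> f = t" by (intro LT_eqI) auto
  ultimately show "LT \<sigma> f \<in> Poly_Mapping.keys f"
    "u \<in> Poly_Mapping.keys f \<Longrightarrow> (u, LT \<sigma> f) \<in> \<sigma>" by auto
qed

text \<open>This includes \<open>f = 0\<close>, for which \<open>LT\<close> is the same unspecified term on both sides.\<close>

lemma LT_restrict_ordering:
  "Poly_Mapping.keys f \<subseteq> terms_in V \<Longrightarrow> LT (restrict_ordering \<sigma> V) f = LT \<sigma> f"
  unfolding LT_def restrict_ordering_def by (rule arg_cong[where f = The]) blast

text \<open>The leading terms of an ideal are closed under multiples.\<close>

lemma LT_multiple:
  assumes "ideal J (mpoly_ring UNIV)" "f \<in> J - {0}"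
  shows "\<exists>g \<in> J - {0}. LT \<sigma> g = LT \<sigma> f + u"
proof -
  let ?g = "term_poly u * f"
  have k: "LT \<sigma> f + u \<in> Poly_Mapping.keys ?g"
    using LT_in_keys[of f] assms(2) lookup_term_poly_mult[of u f "LT \<sigma> f"]
    by (simp add: in_keys_iff add.commute)
  have "(w, LT \<sigma> f + u) \<in> \<sigma>" if w: "w \<in> Poly_Mapping.keys ?g" for w
  proof -
    obtain v where "w = u + v" "v \<in> Poly_Mapping.keys f"
      using w keys_mult[of "term_poly u" f] by auto
    then show ?thesis using LT_max[of f v] assms(2) ord_add[of v "LT \<sigma> f" u]
      by (simp add: add.commute)
  qed
  then have "LT \<sigma> ?g = LT \<sigma> f + u" using k by (intro LT_eqI) auto
  moreover have "?g \<in> J" using assms by (intro mpoly_ideal_closed(3)[OF assms(1)]) auto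
  ultimately show ?thesis using k by (intro bexI[of _ ?g]) auto
qed

text \<open>Every term has a normal form modulo an ideal. Well-founded induction on the term replaces the
  division algorithm: a leading term of the ideal is rewritten to smaller terms, which are then
  replaced by their normal forms.\<close>

lemma normal_form:
  fixes J :: "('x, 'a::field) mpoly set"
  assumes J: "ideal J (mpoly_ring UNIV)"
  shows "\<exists>r. term_poly t - r \<in> J \<and>
    Poly_Mapping.keys r \<subseteq> {u. (u, t) \<in> \<sigma>} - LT \<sigma> ` (J - {0})"
proof (induction t rule: wf_induct_rule[OF ord_wf])
  case (1 t)
  show ?case
  proof (cases "t \<in> LT \<sigma> ` (J - {0})")
    case False
    then show ?thesis
      using mpoly_ideal_closed(1)[OF J] ord_refl by (intro exI[of _ "term_poly t"]) auto
  next
    case True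
    then obtain g where g: "g \<in> J" "g \<noteq> 0" "LT \<sigma> g = t" by blast
    \<comment> \<open>Here \<open>g'\<close> is \<open>g\<close> made monic, so \<open>h\<close> is congruent to \<open>t\<close> and involves only smaller terms.\<close>
    define g' where "g' = const_poly (1 / Poly_Mapping.lookup g t) * g"
    define h where "h = term_poly t - g'"
    have g': "g' \<in> J" unfolding g'_def using g by (intro mpoly_ideal_closed(3)[OF J]) auto
    have below: "(u, t) \<in> \<sigma> - Id" if "u \<in> Poly_Mapping.keys h" for u
    proof -
      have "Poly_Mapping.lookup g t \<noteq> 0" using LT_in_keys[OF g(2)] g(3) by (simp add: in_keys_iff)
      then have "Poly_Mapping.lookup h t = 0"
        by (simp add: h_def g'_def lookup_minus lookup_const_poly_mult term_poly_def)
      with that have "u \<noteq> t" by (auto simp: in_keys_iff)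
      with that have "u \<in> Poly_Mapping.keys g"
        by (auto simp: in_keys_iff h_def g'_def lookup_minus lookup_const_poly_mult term_poly_def
            lookup_single)
      with LT_max[OF g(2)] g(3) \<open>u \<noteq> t\<close> show ?thesis by auto
    qed
    obtain N where N: "\<And>u. u \<in> Poly_Mapping.keys h \<Longrightarrow> term_poly u - N u \<in> J \<and>
        Poly_Mapping.keys (N u) \<subseteq> {v. (v, u) \<in> \<sigma>} - LT \<sigma> ` (J - {0})"
      using 1 below by metis
    let ?c = "\<lambda>u. const_poly (Poly_Mapping.lookup h u)"
    let ?r = "\<Sum>u \<in> Poly_Mapping.keys h. ?c u * N u"
    have "term_poly t - ?r = g' + (h - ?r)" by (simp add: h_def)
    also have "h - ?r = (\<Sum>u \<in> Poly_Mapping.keys h. ?c u * (term_poly u - N u))"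
      by (subst (1) poly_eq_sum_monomials[of h]) (simp add: sum_subtractf right_diff_distrib)
    also have "g' + \<dots> \<in> J"
      using N g' by (intro mpoly_ideal_closed(2)[OF J] mpoly_ideal_sum[OF J]
          mpoly_ideal_closed(3)[OF J]) auto
    finally have "term_poly t - ?r \<in> J" .
    moreover have "Poly_Mapping.keys ?r \<subseteq> {v. (v, t) \<in> \<sigma>} - LT \<sigma> ` (J - {0})"
    proof
      fix v assume "v \<in> Poly_Mapping.keys ?r"
      then obtain u where "u \<in> Poly_Mapping.keys h" "v \<in> Poly_Mapping.keys (N u)"
        using keys_sum[of "\<lambda>u. ?c u * N u" "Poly_Mapping.keys h"] keys_const_poly_mult by blast
      with N[of u] below[of u] show "v \<in> {v. (v, t) \<in> \<sigma>} - LT \<sigma> ` (J - {0})"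
        using ord_trans by blast
    qed
    ultimately show ?thesis by blast
  qed
qed

text \<open>For a leading term \<open>m\<close> of the ideal, the difference of \<open>m\<close> and its normal form.\<close>

lemma reduced_element:
  fixes J :: "('x, 'a::field) mpoly set"
  assumes J: "ideal J (mpoly_ring UNIV)" and m: "m \<in> LT \<sigma> ` (J - {0})"
  shows "\<exists>b \<in> J - {0}. LT \<sigma> b = m \<and> Poly_Mapping.lookup b m = 1 \<and>
    Poly_Mapping.keys b \<inter> LT \<sigma> ` (J - {0}) = {m}"
proof -
  obtain r where r: "term_poly m - r \<in> J"
      "Poly_Mapping.keys r \<subseteq> {u. (u, m) \<in> \<sigma>} - LT \<sigma> ` (J - {0})"
    using normal_form[OF J] by blast
  let ?b = "term_poly m - r"
  have "m \<notin> Poly_Mapping.keys r" using r(2) m by blast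
  then have 1: "Poly_Mapping.lookup ?b m = 1"
    by (simp add: lookup_minus in_keys_iff term_poly_def)
  then have mk: "m \<in> Poly_Mapping.keys ?b" by (simp add: in_keys_iff)
  have k: "Poly_Mapping.keys ?b \<subseteq> insert m (Poly_Mapping.keys r)"
    using keys_diff[of "term_poly m" r] by auto
  have "LT \<sigma> ?b = m" using mk k r(2) ord_refl by (intro LT_eqI) auto
  moreover have "?b \<noteq> 0" using 1 by auto
  moreover have "Poly_Mapping.keys ?b \<inter> LT \<sigma> ` (J - {0}) = {m}" using k mk m r(2) by blast
  ultimately show ?thesis using r(1) 1 by blast
qed

end

section \<open>Substitution\<close>

text \<open>The value of a polynomial under the substitution \<open>x \<mapsto> q x\<close>.\<close>

definition poly_subst :: "('x::finite \<Rightarrow> ('x, 'a::field) mpoly) \<Rightarrow> ('x, 'a) mpoly \<Rightarrow> ('x, 'a) mpoly" where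
  "poly_subst q f = (\<Sum>t \<in> Poly_Mapping.keys f.
     const_poly (Poly_Mapping.lookup f t) * (\<Prod>x \<in> UNIV. q x ^ Poly_Mapping.lookup t x))"

lemma poly_subst_superset:
  "finite A \<Longrightarrow> Poly_Mapping.keys f \<subseteq> A \<Longrightarrow> poly_subst q f =
    (\<Sum>t \<in> A. const_poly (Poly_Mapping.lookup f t) * (\<Prod>x \<in> UNIV. q x ^ Poly_Mapping.lookup t x))"
  unfolding poly_subst_def
  by (rule sum.mono_neutral_left) (auto simp: in_keys_iff const_poly_def)

lemma poly_subst_0 [simp]: "poly_subst q 0 = 0"
  by (simp add: poly_subst_def)

lemma poly_subst_add: "poly_subst q (f + g) = poly_subst q f + poly_subst q g"
proof -
  let ?A = "Poly_Mapping.keys f \<union> Poly_Mapping.keys g"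
  note * = poly_subst_superset[of ?A _ q]
  show ?thesis
    using keys_add[of f g]
    by (subst (1 2 3) *)
      (auto simp: lookup_add const_poly_def single_add distrib_right sum.distrib)
qed

lemma poly_subst_sum: "poly_subst q (sum f A) = (\<Sum>i \<in> A. poly_subst q (f i))"
  by (induction A rule: infinite_finite_induct) (simp_all add: poly_subst_add)

lemma poly_subst_monomial:
  "poly_subst q (const_poly c * term_poly t) =
    const_poly c * (\<Prod>x \<in> UNIV. q x ^ Poly_Mapping.lookup t x)"
  by (cases "c = 0") (simp_all add: const_poly_mult_term_poly poly_subst_def, simp add: const_poly_def)

lemma poly_subst_mult: "poly_subst q (f * g) = poly_subst q f * poly_subst q g"
proof -
  let ?c = "\<lambda>f t. const_poly (Poly_Mapping.lookup f t)"
  let ?S = "\<lambda>t. \<Prod>x \<in> UNIV. q x ^ Poly_Mapping.lookup t x"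
  have monomials: "poly_subst q ((?c f s * term_poly s) * (?c g t * term_poly t)) =
      (?c f s * ?S s) * (?c g t * ?S t)" for s t
  proof -
    have "(?c f s * term_poly s) * (?c g t * term_poly t) =
        const_poly (Poly_Mapping.lookup f s * Poly_Mapping.lookup g t) * term_poly (s + t)"
      by (simp add: const_poly_mult_term_poly mult_single)
    then have "poly_subst q ((?c f s * term_poly s) * (?c g t * term_poly t)) =
        const_poly (Poly_Mapping.lookup f s * Poly_Mapping.lookup g t) * ?S (s + t)"
      by (simp only: poly_subst_monomial)
    also have "\<dots> = (?c f s * ?c g t) * (?S s * ?S t)"
      by (simp add: const_poly_def mult_single lookup_add power_add prod.distrib)
    finally show ?thesis by (simp add: ac_simps)
  qed
  have "f * g = (\<Sum>s \<in> Poly_Mapping.keys f. \<Sum>t \<in> Poly_Mapping.keys g.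
      (?c f s * term_poly s) * (?c g t * term_poly t))"
    by (subst (1) poly_eq_sum_monomials[of f], subst (1) poly_eq_sum_monomials[of g])
      (simp add: sum_product)
  then have "poly_subst q (f * g) = (\<Sum>s \<in> Poly_Mapping.keys f. \<Sum>t \<in> Poly_Mapping.keys g.
      (?c f s * ?S s) * (?c g t * ?S t))"
    by (simp only: poly_subst_sum monomials)
  also have "\<dots> = poly_subst q f * poly_subst q g" by (simp add: poly_subst_def sum_product)
  finally show ?thesis .
qed

lemma ideal_poly_subst_kernel: "ideal {f. poly_subst q f = 0} (mpoly_ring UNIV)"
  by (rule mpoly_idealI) (auto simp: poly_subst_add poly_subst_mult)

lemma pp_eq_sum: "t = (\<Sum>x \<in> UNIV. Poly_Mapping.single x (Poly_Mapping.lookup (t :: 'x::finite pp) x))"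
  by (rule poly_mapping_eqI) (simp add: lookup_sum lookup_single when_def)

lemma subst_term_fixed:
  fixes q :: "'x::finite \<Rightarrow> ('x, 'a::field) mpoly"
  assumes "\<And>x. x \<in> Poly_Mapping.keys t \<Longrightarrow> q x = term_poly (var x)"
  shows "(\<Prod>x \<in> UNIV. q x ^ Poly_Mapping.lookup t x) = term_poly t"
proof -
  have pow: "term_poly (var x) ^ n = (term_poly (Poly_Mapping.single x n) :: ('x, 'a) mpoly)" for x n
    by (induction n)
      (simp_all add: term_poly_def var_def mult_single single_add[symmetric])
  have "q x ^ Poly_Mapping.lookup t x = term_poly (Poly_Mapping.single x (Poly_Mapping.lookup t x))" for x
    using assms[of x] by (cases "x \<in> Poly_Mapping.keys t") (simp_all add: pow in_keys_iff term_poly_0)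
  moreover have "(\<Prod>x \<in> A. term_poly (h x)) = (term_poly (sum h A) :: ('x, 'a) mpoly)"
    if "finite A" for h and A :: "'x set"
    using that by (induction A rule: finite_induct) (simp_all add: term_poly_def mult_single)
  ultimately show ?thesis by (subst (2) pp_eq_sum[of t]) simp
qed

lemma poly_subst_fixed:
  assumes "Poly_Mapping.keys f \<subseteq> terms_in V" "\<And>x. x \<in> V \<Longrightarrow> q x = term_poly (var x)"
  shows "poly_subst q f = f"
proof -
  have "(\<Prod>x \<in> UNIV. q x ^ Poly_Mapping.lookup t x) = term_poly t" if "t \<in> Poly_Mapping.keys f" for t
    using assms that by (intro subst_term_fixed) (auto simp: terms_in_def)
  then have "poly_subst q f =
      (\<Sum>t \<in> Poly_Mapping.keys f. const_poly (Poly_Mapping.lookup f t) * term_poly t)"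
    by (simp add: poly_subst_def)
  then show ?thesis by (simp add: poly_eq_sum_monomials[symmetric])
qed

lemma poly_subst_var: "poly_subst q (term_poly (var x)) = q x"
proof -
  have "(\<Prod>y \<in> UNIV. q y ^ Poly_Mapping.lookup (var x) y) = (\<Prod>y \<in> UNIV. if y = x then q y else 1)"
    by (rule prod.cong) (simp_all add: var_def lookup_single when_def)
  with poly_subst_monomial[of q 1 "var x"] show ?thesis by (simp add: const_poly_1)
qed

context term_order
begin

lemma subst_term_below:
  fixes q :: "'x \<Rightarrow> ('x, 'a::field) mpoly"
  assumes q: "\<And>x. Poly_Mapping.keys (q x) \<subseteq> {u. (u, var x) \<in> \<sigma>}"
  shows "Poly_Mapping.keys (\<Prod>x \<in> UNIV. q x ^ Poly_Mapping.lookup t x) \<subseteq> {u. (u, t) \<in> \<sigma>}"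
proof -
  have mult: "Poly_Mapping.keys (f * g) \<subseteq> {u. (u, s + t) \<in> \<sigma>}"
    if "Poly_Mapping.keys f \<subseteq> {u. (u, s) \<in> \<sigma>}" "Poly_Mapping.keys g \<subseteq> {u. (u, t) \<in> \<sigma>}"
    for f g :: "('x, 'a) mpoly" and s t
    using that keys_mult[of f g] ord_add_mono by blast
  have power: "Poly_Mapping.keys (q x ^ n) \<subseteq> {u. (u, Poly_Mapping.single x n) \<in> \<sigma>}" for x n
  proof (induction n)
    case (Suc n)
    then show ?case using mult[OF q[of x] Suc.IH] by (simp add: var_def single_add[symmetric])
  qed (simp add: ord_refl)
  have "Poly_Mapping.keys (\<Prod>x \<in> A. q x ^ Poly_Mapping.lookup t x) \<subseteq>
      {u. (u, \<Sum>x \<in> A. Poly_Mapping.single x (Poly_Mapping.lookup t x)) \<in> \<sigma>}" if "finite A" for A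
    using that
  proof (induction A rule: finite_induct)
    case (insert x A)
    then show ?case using mult[OF power insert.IH] by simp
  qed (simp add: ord_refl)
  from this[of UNIV] show ?thesis by (simp add: pp_eq_sum[symmetric])
qed

text \<open>A substitution that fixes the indeterminates in \<open>V\<close> and maps each indeterminate to a combination of
  terms not larger than it keeps the coefficient of a leading term in \<open>V\<close>: another term of the
  polynomial is smaller, so that its image cannot contain the leading term.\<close>

lemma poly_subst_neq_0:
  assumes f: "f \<noteq> 0" "LT \<sigma> f \<in> terms_in V"
    and q: "\<And>x. Poly_Mapping.keys (q x) \<subseteq> {u. (u, var x) \<in> \<sigma>}"
    and fixed: "\<And>x. x \<in> V \<Longrightarrow> q x = term_poly (var x)"
  shows "poly_subst q f \<noteq> 0"
proof
  assume 0: "poly_subst q f = 0"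
  let ?S = "\<lambda>t. \<Prod>x \<in> UNIV. q x ^ Poly_Mapping.lookup t x"
  have S: "?S (LT \<sigma> f) = term_poly (LT \<sigma> f)"
    using f(2) fixed by (intro subst_term_fixed) (auto simp: terms_in_def)
  have other: "Poly_Mapping.lookup (?S t) (LT \<sigma> f) = 0"
    if "t \<in> Poly_Mapping.keys f" "t \<noteq> LT \<sigma> f" for t
  proof (rule ccontr)
    assume "Poly_Mapping.lookup (?S t) (LT \<sigma> f) \<noteq> 0"
    then have "(LT \<sigma> f, t) \<in> \<sigma>" using subst_term_below[OF q, where t = t] by (auto simp: in_keys_iff)
    with LT_max[OF f(1) that(1)] that(2) show False using ord_antisym by blast
  qed
  have "Poly_Mapping.lookup (poly_subst q f) (LT \<sigma> f) = (\<Sum>t \<in> Poly_Mapping.keys f.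
      Poly_Mapping.lookup f t * Poly_Mapping.lookup (?S t) (LT \<sigma> f))"
    by (simp add: poly_subst_def lookup_sum lookup_const_poly_mult)
  also have "\<dots> = (\<Sum>t \<in> Poly_Mapping.keys f. if t = LT \<sigma> f then Poly_Mapping.lookup f t else 0)"
    by (rule sum.cong) (auto simp: other S term_poly_def)
  also have "\<dots> = Poly_Mapping.lookup f (LT \<sigma> f)" using LT_in_keys[OF f(1)] by simp
  finally show False using 0 LT_in_keys[OF f(1)] by (simp add: in_keys_iff)
qed

end

section \<open>Separating indeterminates\<close>

lemma var_eq_addD: "var z = t + u \<Longrightarrow> t = 0 \<or> t = var (z :: 'x)"
proof -
  assume eq: "var z = t + u"
  have sum: "Poly_Mapping.lookup t x + Poly_Mapping.lookup u x = (if x = z then 1 else 0)" for x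
  proof -
    have "Poly_Mapping.lookup t x + Poly_Mapping.lookup u x = Poly_Mapping.lookup (var z) x"
      by (simp only: eq lookup_add)
    then show ?thesis by (auto simp: var_def lookup_single when_def)
  qed
  have "Poly_Mapping.lookup t x = 0" if "x \<noteq> z" for x using sum[of x] that by simp
  then have "t = Poly_Mapping.single z (Poly_Mapping.lookup t z)"
    by (intro poly_mapping_eqI) (simp add: lookup_single when_def)
  moreover have "Poly_Mapping.lookup t z = 0 \<or> Poly_Mapping.lookup t z = 1" using sum[of z] by auto
  ultimately show ?thesis by (metis single_zero var_def)
qed

lemma var_dvd_iff: "(\<exists>u. t = var z + u) \<longleftrightarrow> z \<in> Poly_Mapping.keys (t :: 'x pp)"
  by (auto simp: pp_dvd_iff var_def lookup_single when_def in_keys_iff Suc_le_eq)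

lemma not_terms_in_ComplE:
  assumes "t \<notin> terms_in (- Z)" obtains z u where "z \<in> Z" "t = var z + u"
  using assms that var_dvd_iff by (fastforce simp: terms_in_def)

lemma var_add_notin_terms_in: "var z + u \<in> terms_in V \<Longrightarrow> z \<in> V"
  using var_dvd_iff[of "var z + u" z] by (auto simp: terms_in_def)

text \<open>An ideal \<open>J\<close> none of whose elements has a constant term, such that each \<open>z \<in> Z\<close> is a leading term of \<open>J\<close>, and for each
  leading term \<open>m\<close> of \<open>J\<close> a monic \<open>b m \<in> J\<close> with leading term \<open>m\<close> and no other leading term of \<open>J\<close>
  in its support.\<close>

locale separated_ideal = term_order \<sigma> for \<sigma> :: "'x::finite pp rel" +
  fixes J :: "('x, 'a::field) mpoly set" and b :: "'x pp \<Rightarrow> ('x, 'a) mpoly" and Z :: "'x set"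
  assumes ideal: "ideal J (mpoly_ring UNIV)"
    and no_constant: "\<And>f. f \<in> J \<Longrightarrow> 0 \<notin> Poly_Mapping.keys f"
    and Z_leading: "var ` Z \<subseteq> LT \<sigma> ` (J - {0})"
    and b: "\<And>m. m \<in> LT \<sigma> ` (J - {0}) \<Longrightarrow> b m \<in> J - {0} \<and> LT \<sigma> (b m) = m \<and>
      Poly_Mapping.lookup (b m) m = 1 \<and> Poly_Mapping.keys (b m) \<inter> LT \<sigma> ` (J - {0}) = {m}"
begin

abbreviation "leading \<equiv> LT \<sigma> ` (J - {0})"

lemma leading_add: "t \<in> leading \<Longrightarrow> t + u \<in> leading"
proof -
  assume "t \<in> leading"
  then obtain f where f: "f \<in> J - {0}" "t = LT \<sigma> f" by (rule imageE)
  then obtain g where "g \<in> J - {0}" "LT \<sigma> g = t + u" using LT_multiple[OF ideal f(1), of u] by blast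
  then show "t + u \<in> leading" by (metis imageI)
qed

lemma minimal_in_leading: "m \<in> minimal_terms leading \<Longrightarrow> m \<in> leading"
  by (simp add: minimal_terms_def)

text \<open>If \<open>m'\<close> divides a term \<open>t\<close> of \<open>b m\<close>, then \<open>t\<close> is a leading term, so \<open>t = m\<close>, and \<open>m' = m\<close> by
  minimality.\<close>

lemma b_reduced:
  assumes "m \<in> minimal_terms leading" "m' \<in> minimal_terms leading" "b m' \<noteq> b m"
    and t: "t \<in> Poly_Mapping.keys (b m)"
  shows "t \<noteq> m' + u"
proof
  assume eq: "t = m' + u"
  have "t \<in> leading" unfolding eq using assms(2) by (intro leading_add minimal_in_leading)
  with t b[of m] minimal_in_leading[OF assms(1)] have "t = m" by blast
  with eq assms(1,2) have "m' = m" by (auto simp: minimal_terms_def)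
  with assms(3) show False by simp
qed

text \<open>A set \<open>M\<close> of minimal leading terms of \<open>J\<close> with \<open>b ` M \<subseteq> H \<subseteq> J\<close> gives a reduced Groebner basis
  of \<open>H\<close> as soon as each leading term of \<open>H\<close> is a multiple of some \<open>m \<in> M\<close>. The relation \<open>\<rho>\<close> allows for
  both \<open>\<sigma>\<close> and its restriction to the terms in \<open>V\<close>.\<close>

lemma reduced_basisI:
  assumes M: "M \<subseteq> minimal_terms leading" and "b ` M \<subseteq> H" "H \<subseteq> J"
    and H: "H \<subseteq> carrier (mpoly_ring V)"
    and LT: "\<And>f :: ('x, 'a) mpoly. Poly_Mapping.keys f \<subseteq> terms_in V \<Longrightarrow> LT \<rho> f = LT \<sigma> f"
    and dvd: "\<And>f. f \<in> H \<Longrightarrow> f \<noteq> 0 \<Longrightarrow> \<exists>m \<in> M. \<exists>u. LT \<sigma> f = m + u"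
  shows "reduced_groebner_basis V \<rho> H (b ` M)"
proof -
  have LT': "LT \<rho> f = LT \<sigma> f" if "f \<in> H" for f using H that by (intro LT) auto
  have bM: "b m \<in> H - {0}" and LT_b: "LT \<rho> (b m) = m" if "m \<in> M" for m
  proof -
    have "m \<in> leading" using M that minimal_in_leading by blast
    with b[of m] that assms(2) LT'[of "b m"] show "b m \<in> H - {0}" "LT \<rho> (b m) = m" by auto
  qed
  have "groebner_basis V \<rho> H (b ` M)"
  proof (rule groebner_basisI)
    show "finite (b ` M)" using M finite_minimal_terms finite_subset by blast
    show "b ` M \<subseteq> H - {0}" using bM by (simp add: image_subset_iff)
    fix f assume f: "f \<in> H - {0}"
    then have LTf: "LT \<rho> f = LT \<sigma> f" using LT' by simp
    show "LT \<rho> f \<in> Poly_Mapping.keys f" using f LTf LT_in_keys[of f] by simp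
    obtain m u where m: "m \<in> M" "LT \<sigma> f = m + u" using f dvd[of f] by auto
    then have "LT \<rho> f = LT \<rho> (b m) + u" using LTf LT_b by simp
    with m(1) show "\<exists>g \<in> b ` M. \<exists>u. LT \<rho> f = LT \<rho> g + u" by blast
  qed (fact H)
  moreover have "LC \<rho> (b m) = 1" if "m \<in> M" for m
  proof -
    have "m \<in> leading" using M that minimal_in_leading by blast
    with b[of m] LT_b[OF that] show ?thesis by (simp add: LC_def)
  qed
  moreover have "t \<noteq> LT \<rho> (b m') + u"
    if "m \<in> M" "m' \<in> M" "b m' \<noteq> b m" "t \<in> Poly_Mapping.keys (b m)" for m m' t u
    using b_reduced[of m m' t u] that M LT_b[of m'] by (simp add: subset_iff)
  ultimately show ?thesis unfolding reduced_groebner_basis_def by blast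
qed

lemma leading_basis: "reduced_groebner_basis UNIV \<sigma> J (b ` minimal_terms leading)"
proof (rule reduced_basisI)
  show "b ` minimal_terms leading \<subseteq> J" using b minimal_in_leading by blast
  show "\<exists>m \<in> minimal_terms leading. \<exists>u. LT \<sigma> f = m + u" if "f \<in> J" "f \<noteq> 0" for f
    using that by (intro minimal_term_dvd) blast
qed simp_all

lemma var_minimal:
  assumes "z \<in> Z" shows "var z \<in> minimal_terms leading"
proof -
  have "0 \<notin> leading" using no_constant LT_in_keys by force
  then have "t = var z" if "t \<in> leading" "var z = t + u" for t u
    using var_eq_addD[OF that(2)] that(1) by auto
  moreover have "var z \<in> leading" using Z_leading assms by blast
  ultimately show ?thesis unfolding minimal_terms_def by blast
qed

text \<open>A term divisible by some \<open>z \<in> Z\<close> is a leading term of \<open>J\<close>, so in \<open>b m\<close> it can only be \<open>m\<close>.\<close>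

lemma keys_b:
  assumes "m \<in> leading" shows "Poly_Mapping.keys (b m) \<subseteq> insert m (terms_in (- Z))"
proof
  fix t assume t: "t \<in> Poly_Mapping.keys (b m)"
  show "t \<in> insert m (terms_in (- Z))"
  proof (rule ccontr)
    assume not: "t \<notin> insert m (terms_in (- Z))"
    then obtain z u where "z \<in> Z" "t = var z + u" using not_terms_in_ComplE by blast
    then have "t \<in> leading" using Z_leading leading_add by blast
    with t not b[OF assms] show False by blast
  qed
qed

lemma elimination_basis:
  "reduced_groebner_basis (- Z) (restrict_ordering \<sigma> (- Z)) (J \<inter> carrier (mpoly_ring (- Z)))
    (b ` (minimal_terms leading - var ` Z))"
proof (rule reduced_basisI)
  have "m \<in> terms_in (- Z)" if m: "m \<in> minimal_terms leading" "m \<notin> var ` Z" for m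
  proof (rule ccontr)
    assume "m \<notin> terms_in (- Z)"
    then obtain z u where "z \<in> Z" "m = var z + u" using not_terms_in_ComplE by blast
    moreover from this Z_leading have "var z \<in> leading" by blast
    ultimately have "var z = m" using m(1) unfolding minimal_terms_def by blast
    with m(2) \<open>z \<in> Z\<close> show False by blast
  qed
  then have "b m \<in> J \<and> Poly_Mapping.keys (b m) \<subseteq> terms_in (- Z)"
    if "m \<in> minimal_terms leading - var ` Z" for m
    using b[of m] keys_b[of m] minimal_in_leading[of m] that by blast
  then show "b ` (minimal_terms leading - var ` Z) \<subseteq> J \<inter> carrier (mpoly_ring (- Z))"
    by (simp add: image_subset_iff)
next
  fix f assume f: "f \<in> J \<inter> carrier (mpoly_ring (- Z))" "f \<noteq> 0"
  then obtain m u where m: "m \<in> minimal_terms leading" "LT \<sigma> f = m + u"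
    using minimal_term_dvd[of "LT \<sigma> f" leading] by auto
  moreover have "m + u \<in> terms_in (- Z)" using f LT_in_keys[of f] m(2) by auto
  then have "m \<notin> var ` Z" using var_add_notin_terms_in by fastforce
  ultimately show "\<exists>m \<in> minimal_terms leading - var ` Z. \<exists>u. LT \<sigma> f = m + u" by blast
qed (auto intro: LT_restrict_ordering)

text \<open>The substitution \<open>z \<mapsto> z - b z\<close> for \<open>z \<in> Z\<close> annihilates the ideal generated by the \<open>b z\<close>, so
  that no leading term of this ideal lies in the remaining indeterminates.\<close>

lemma gen_ideal_basis:
  assumes fs: "set fs = b ` var ` Z"
  shows "reduced_groebner_basis UNIV \<sigma> (gen_ideal fs) (set fs)"
proof -
  define q where "q x = (if x \<in> Z then term_poly (var x) - b (var x) else term_poly (var x))" for x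
  have bz: "b (var z) \<in> J - {0}" "LT \<sigma> (b (var z)) = var z" "var z \<in> leading"
    "Poly_Mapping.lookup (b (var z)) (var z) = 1" if "z \<in> Z" for z
    using b[of "var z"] Z_leading that by auto
  have q_keys: "Poly_Mapping.keys (q z) \<subseteq> Poly_Mapping.keys (b (var z)) - {var z}" if "z \<in> Z" for z
    using that bz(4)
    by (auto simp: q_def in_keys_iff lookup_minus term_poly_def lookup_single when_def split: if_splits)
  have q_below: "Poly_Mapping.keys (q x) \<subseteq> {u. (u, var x) \<in> \<sigma>}" for x
  proof (cases "x \<in> Z")
    case True
    with q_keys[of x] bz[of x] LT_max[of "b (var x)"] show ?thesis by auto
  qed (simp add: q_def ord_refl)
  have q_fixed: "q x = term_poly (var x)" if "x \<in> - Z" for x using that by (simp add: q_def)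
  have "poly_subst q (b (var z)) = 0" if z: "z \<in> Z" for z
  proof -
    have "poly_subst q (q z) = q z"
      using q_keys[OF z] keys_b[OF bz(3)[OF z]] by (intro poly_subst_fixed[OF _ q_fixed]) auto
    moreover have "term_poly (var z) = b (var z) + q z" using z by (simp add: q_def)
    then have "poly_subst q (b (var z)) + poly_subst q (q z) = q z"
      by (metis poly_subst_add poly_subst_var)
    ultimately show ?thesis by simp
  qed
  then have "gen_ideal fs \<subseteq> {f. poly_subst q f = 0}"
    unfolding gen_ideal_def using fs
    by (intro ring.genideal_minimal[OF ring_mpoly_ring ideal_poly_subst_kernel]) auto
  then have LT_Z: "LT \<sigma> f \<notin> terms_in (- Z)" if "f \<in> gen_ideal fs" "f \<noteq> 0" for f
    using that poly_subst_neq_0[OF that(2) _ q_below q_fixed, of "- Z"] by blast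
  have "reduced_groebner_basis UNIV \<sigma> (gen_ideal fs) (b ` var ` Z)"
  proof (rule reduced_basisI)
    show "var ` Z \<subseteq> minimal_terms leading" using var_minimal by blast
    show "b ` var ` Z \<subseteq> gen_ideal fs"
      unfolding gen_ideal_def fs[symmetric] by (rule ring.genideal_self[OF ring_mpoly_ring]) simp
    show "gen_ideal fs \<subseteq> J"
      unfolding gen_ideal_def fs using bz(1)
      by (intro ring.genideal_minimal[OF ring_mpoly_ring ideal]) auto
    show "\<exists>m \<in> var ` Z. \<exists>u. LT \<sigma> f = m + u" if "f \<in> gen_ideal fs" "f \<noteq> 0" for f
      using LT_Z[OF that] not_terms_in_ComplE by blast
  qed simp_all
  then show ?thesis by (simp add: fs)
qed

end

theorem proposition4p2:
  fixes zs :: "'x::finite list"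
    and I :: "('x, 'a::field) mpoly set"
    and \<sigma> :: "'x pp rel"
  assumes "zs \<noteq> []" and "distinct zs"
    and "ideal I (mpoly_ring UNIV)" and "I \<subseteq> maximal_ideal_vars"
    and "term_ordering \<sigma>"
  defines "Y \<equiv> - set zs"
  defines "A \<equiv> separating_ordering_ideal zs \<sigma> I"
    and "B \<equiv> (\<exists>fs. length fs = length zs \<and> set fs \<subseteq> I - {0} \<and>
                separating_ordering_tuple zs \<sigma> fs)"
    and "C \<equiv> (\<exists>fs. length fs = length zs \<and> set fs \<subseteq> I - {0} \<and>
                (\<forall>i < length zs. LT \<sigma> (fs ! i) = var (zs ! i)) \<and>
                coherently_separating_tuple zs fs)"
    and "D \<equiv> (\<exists>fs G. reduced_groebner_basis UNIV \<sigma> I (set fs \<union> G) \<and>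
                (\<forall>i < length zs. LT \<sigma> (fs ! i) = var (zs ! i)) \<and>
                coherently_separating_tuple zs fs \<and>
                reduced_groebner_basis Y (restrict_ordering \<sigma> Y)
                  (I \<inter> carrier (mpoly_ring Y)) G)"
  shows "(A \<longleftrightarrow> B) \<and> (B \<longleftrightarrow> C) \<and> (C \<longleftrightarrow> D)"
proof -
  interpret term_order \<sigma> by (rule term_order.intro) fact
  have no_constant: "0 \<notin> Poly_Mapping.keys f" if "f \<in> I" for f
    using maximal_ideal_vars_0 that assms(4) by blast
  have "B" if A
  proof -
    from that obtain fs where fs: "set fs \<subseteq> I - {0}"
        "LT_ideal UNIV \<sigma> (gen_ideal fs) = Idl\<^bsub>mpoly_ring UNIV\<^esub> ((\<lambda>z. term_poly (var z)) ` set zs)"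
      unfolding A_def separating_ordering_ideal_def separating_ordering_gen_ideal_def by blast
    have sub: "gen_ideal fs \<subseteq> I"
      unfolding gen_ideal_def using fs(1)
      by (intro ring.genideal_minimal[OF ring_mpoly_ring assms(3)]) auto
    have "\<exists>g \<in> I - {0}. LT \<sigma> g = var z" if z: "z \<in> set zs" for z
    proof -
      have "term_poly (var z) \<in>
          (Idl\<^bsub>mpoly_ring UNIV\<^esub> ((\<lambda>z. term_poly (var z)) ` set zs) :: ('x, 'a) mpoly set)"
        using z ring.genideal_self[OF ring_mpoly_ring, of "(\<lambda>z. term_poly (var z)) ` set zs" UNIV]
        by auto
      then have "term_poly (var z) \<in>
          (Idl\<^bsub>mpoly_ring UNIV\<^esub> (term_poly ` LT \<sigma> ` (gen_ideal fs - {0})) :: ('x, 'a) mpoly set)"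
        by (simp add: fs(2)[symmetric] LT_ideal_def image_image)
      then obtain g u where g: "g \<in> gen_ideal fs - {0}" "var z = LT \<sigma> g + u"
        using keys_in_monomial_ideal[of "term_poly (var z)" _ "var z"] by fastforce
      moreover have "LT \<sigma> g \<noteq> 0" using no_constant[of g] LT_in_keys[of g] g(1) sub by auto
      ultimately show ?thesis using var_eq_addD[OF g(2)] sub by auto
    qed
    then obtain g where g: "\<And>z. z \<in> set zs \<Longrightarrow> g z \<in> I - {0} \<and> LT \<sigma> (g z) = var z" by metis
    then show B
      unfolding B_def separating_ordering_tuple_def using assms(4,5)
      by (intro exI[of _ "map g zs"]) auto
  qed
  moreover have "A \<and> C \<and> D" if B
  proof -
    have Z: "var ` set zs \<subseteq> LT \<sigma> ` (I - {0})"
    proof clarify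
      fix z assume "z \<in> set zs"
      with that show "var z \<in> LT \<sigma> ` (I - {0})"
        unfolding B_def separating_ordering_tuple_def in_set_conv_nth
        by (metis image_eqI nth_mem subsetD)
    qed
    obtain b where b: "\<forall>m \<in> LT \<sigma> ` (I - {0}). b m \<in> I - {0} \<and> LT \<sigma> (b m) = m \<and>
        Poly_Mapping.lookup (b m) m = 1 \<and> Poly_Mapping.keys (b m) \<inter> LT \<sigma> ` (I - {0}) = {m}"
      using reduced_element[OF assms(3)] by metis
    then interpret separated_ideal \<sigma> I b "set zs"
      by (intro separated_ideal.intro separated_ideal_axioms.intro term_order_axioms
          assms(3) no_constant Z b[rule_format])
    define fs where "fs = map (\<lambda>z. b (var z)) zs"
    define G where "G = b ` (minimal_terms leading - var ` set zs)"
    have fs: "set fs = b ` var ` set zs" by (auto simp: fs_def)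
    have bz: "b (var z) \<in> I - {0}" "LT \<sigma> (b (var z)) = var z" "LC \<sigma> (b (var z)) = 1"
      if "z \<in> set zs" for z
      using b[rule_format, OF subsetD[OF Z imageI[OF that]]] by (simp_all add: LC_def)
    have len: "length fs = length zs" and fsI: "set fs \<subseteq> I - {0}"
      and LT: "\<forall>i < length zs. LT \<sigma> (fs ! i) = var (zs ! i)"
      using bz by (auto simp: fs_def)
    note basis = gen_ideal_basis[OF fs]
    \<comment> \<open>The elements of \<open>fs\<close> are monic already, so that normalizing them changes nothing.\<close>
    have "(\<lambda>f. const_poly (1 / LC \<sigma> f) * f) ` set fs = (\<lambda>f. f) ` set fs"
      using bz(3) by (intro image_cong) (auto simp: fs const_poly_1)
    then have coherent: "coherently_separating_tuple zs fs"
      unfolding coherently_separating_tuple_def separating_ordering_tuple_def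
      using assms(4,5) len fsI LT basis by (intro exI[of _ \<sigma>]) auto
    have "(\<lambda>g. term_poly (LT \<sigma> g)) ` set fs = ((\<lambda>z. term_poly (var z)) ` set zs :: ('x, 'a) mpoly set)"
      unfolding fs image_image using bz(2) by (intro image_cong) auto
    then have "LT_ideal UNIV \<sigma> (gen_ideal fs) =
        Idl\<^bsub>mpoly_ring UNIV\<^esub> ((\<lambda>z. term_poly (var z)) ` set zs)"
      using basis by (simp add: reduced_groebner_basis_def groebner_basis_def)
    then have A
      unfolding A_def separating_ordering_ideal_def separating_ordering_gen_ideal_def
      using len fsI assms(4,5) by blast
    moreover have C unfolding C_def using len fsI LT coherent by blast
    moreover have "set fs \<union> G = b ` minimal_terms leading"
      using var_minimal by (auto simp: fs G_def)
    then have D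
      unfolding D_def Y_def using LT coherent leading_basis elimination_basis
      by (intro exI[of _ fs] exI[of _ G]) (simp add: G_def)
    ultimately show ?thesis by blast
  qed
  moreover have B if C
    using that assms(4,5) unfolding B_def C_def separating_ordering_tuple_def by blast
  moreover have C if D
  proof -
    from that obtain fs G where fs: "reduced_groebner_basis UNIV \<sigma> I (set fs \<union> G)"
        "\<forall>i < length zs. LT \<sigma> (fs ! i) = var (zs ! i)" "coherently_separating_tuple zs fs"
      unfolding D_def by blast
    then have "length fs = length zs" "set fs \<subseteq> I - {0}"
      by (auto simp: coherently_separating_tuple_def separating_ordering_tuple_def
          reduced_groebner_basis_def groebner_basis_def)
    with fs(2,3) show C unfolding C_def by blast
  qed
  ultimately show ?thesis by blast
qed

end
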